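(* Let $B$ be a supersoluble brace. Then $\partial(B)=\operatorname{Soc}_n(\partial(B))$ for some $n\in\mathbb{N}$, where $\partial(B)$ is regarded as a brace.
   Context: A brace (skew left brace) is a set $B$ with two binary operations $+$ and $\cdot$ such that $(B,+)$ and $(B,\cdot)$ are groups and $a(b+c)=ab-a+ac$ for all $a,b,c\in B$. $\lambda_a(b)=-a+ab$ defines a homomorphism $\lambda\colon(B,\cdot)\to\operatorname{Aut}(B,+)$; $a*b=-a+ab-b$; $B*B$ is the additive subgroup generated by all $a*b$. An ideal is a subset that is a subgroup of both groups, normal in both, and invariant under all $\lambda_b$; quotients by ideals are braces, and ideals are braces. $\operatorname{Soc}(C)=\operatorname{Ker}\lambda\cap Z(C,+)$ for a brace $C$; $\operatorname{Soc}_0(C)=\{0\}$, $\operatorname{Soc}_{k+1}(C)/\operatorname{Soc}_k(C)=\operatorname{Soc}(C/\operatorname{Soc}_k(C))$. The derived ideal is $\partial(B)=\langle B*B,[B,B]_+\rangle_+$, the subgroup of $(B,+)$ generated by $B*B$ and the commutator subgroup of $(B,+)$; it is an ideal. $B$ is supersoluble if there is a finite chain of ideals $\{0\}=I_0\le\dots\le I_n=B$ such that for each $i$, either $(I_{i+1}/I_i,+)$ is infinite cyclic and $I_{i+1}/I_i\le\operatorname{Soc}(B/I_i)$, or $I_{i+1}/I_i$ has prime order. *)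

theory Defs
  imports "HOL-Algebra.Algebra"
begin

record 'a brace =
  bcarrier :: "'a set"
  bplus :: "'a \<Rightarrow> 'a \<Rightarrow> 'a"
  btimes :: "'a \<Rightarrow> 'a \<Rightarrow> 'a"

definition bzero :: "'a brace \<Rightarrow> 'a" where
  "bzero B = (THE e. e \<in> bcarrier B \<and> (\<forall>x\<in>bcarrier B. bplus B e x = x \<and> bplus B x e = x))"

definition bone :: "'a brace \<Rightarrow> 'a" where
  "bone B = (THE e. e \<in> bcarrier B \<and> (\<forall>x\<in>bcarrier B. btimes B e x = x \<and> btimes B x e = x))"

definition add_grp :: "'a brace \<Rightarrow> 'a monoid" where
  "add_grp B = \<lparr>carrier = bcarrier B, monoid.mult = bplus B, one = bzero B\<rparr>"

definition mul_grp :: "'a brace \<Rightarrow> 'a monoid" where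
  "mul_grp B = \<lparr>carrier = bcarrier B, monoid.mult = btimes B, one = bone B\<rparr>"

definition bneg :: "'a brace \<Rightarrow> 'a \<Rightarrow> 'a" where
  "bneg B a = inv\<^bsub>add_grp B\<^esub> a"

definition is_brace :: "'a brace \<Rightarrow> bool" where
  "is_brace B \<longleftrightarrow> group (add_grp B) \<and> group (mul_grp B) \<and>
     (\<forall>a\<in>bcarrier B. \<forall>b\<in>bcarrier B. \<forall>c\<in>bcarrier B.
        btimes B a (bplus B b c) = bplus B (bplus B (btimes B a b) (bneg B a)) (btimes B a c))"

definition blambda :: "'a brace \<Rightarrow> 'a \<Rightarrow> 'a \<Rightarrow> 'a" where
  "blambda B a b = bplus B (bneg B a) (btimes B a b)"

definition bstar :: "'a brace \<Rightarrow> 'a \<Rightarrow> 'a \<Rightarrow> 'a" where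
  "bstar B a b = bplus B (bplus B (bneg B a) (btimes B a b)) (bneg B b)"

definition bstar_set :: "'a brace \<Rightarrow> 'a set" where
  "bstar_set B = generate (add_grp B) {bstar B a b | a b. a \<in> bcarrier B \<and> b \<in> bcarrier B}"

definition bderived :: "'a brace \<Rightarrow> 'a set" where
  "bderived B = generate (add_grp B) (bstar_set B \<union> derived (add_grp B) (bcarrier B))"

definition brace_ideal :: "'a set \<Rightarrow> 'a brace \<Rightarrow> bool" where
  "brace_ideal I B \<longleftrightarrow> subgroup I (add_grp B) \<and> subgroup I (mul_grp B) \<and>
     normal I (add_grp B) \<and> normal I (mul_grp B) \<and>
     (\<forall>b\<in>bcarrier B. \<forall>x\<in>I. blambda B b x \<in> I)"

definition sub_brace :: "'a brace \<Rightarrow> 'a set \<Rightarrow> 'a brace" where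
  "sub_brace B I = \<lparr>bcarrier = I, bplus = bplus B, btimes = btimes B\<rparr>"

text \<open>Quotient brace \<open>B/I\<close>: elements are the additive cosets \<open>a + I\<close> (which for an ideal
  coincide with the multiplicative cosets \<open>aI\<close>), with the induced operations given by
  complex (set) addition and multiplication.\<close>

definition quot_brace :: "'a brace \<Rightarrow> 'a set \<Rightarrow> 'a set brace" where
  "quot_brace B I = \<lparr>bcarrier = {a <#\<^bsub>add_grp B\<^esub> I | a. a \<in> bcarrier B},
                     bplus = set_mult (add_grp B), btimes = set_mult (mul_grp B)\<rparr>"

definition bsoc :: "'a brace \<Rightarrow> 'a set" where
  "bsoc C = {a \<in> bcarrier C. (\<forall>b\<in>bcarrier C. blambda C a b = b) \<and>
                              (\<forall>b\<in>bcarrier C. bplus C a b = bplus C b a)}"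

primrec bsocn :: "'a brace \<Rightarrow> nat \<Rightarrow> 'a set" where
  "bsocn C 0 = {bzero C}"
| "bsocn C (Suc k) = {a \<in> bcarrier C. a <#\<^bsub>add_grp C\<^esub> bsocn C k \<in> bsoc (quot_brace C (bsocn C k))}"

definition supersoluble :: "'a brace \<Rightarrow> bool" where
  "supersoluble B \<longleftrightarrow> (\<exists>n::nat. \<exists>I :: nat \<Rightarrow> 'a set.
     I 0 = {bzero B} \<and> I n = bcarrier B \<and>
     (\<forall>i\<le>n. brace_ideal (I i) B) \<and>
     (\<forall>i<n. I i \<subseteq> I (Suc i) \<and>
        ((infinite (bcarrier (quot_brace (sub_brace B (I (Suc i))) (I i))) \<and>
          cyclic_group (add_grp (quot_brace (sub_brace B (I (Suc i))) (I i))) \<and>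
          bcarrier (quot_brace (sub_brace B (I (Suc i))) (I i)) \<subseteq> bsoc (quot_brace B (I i)))
         \<or> Factorial_Ring.prime (card (bcarrier (quot_brace (sub_brace B (I (Suc i))) (I i)))))))"

end

theory Submission
  imports Defs
begin

text \<open>Intersecting the given chain of ideals \<open>I i\<close> with the derived ideal \<open>D\<close> gives a chain with
  \<open>D \<inter> I i \<subseteq> Soc\<^sub>i(D)\<close>, because \<open>D\<close> centralizes, in both senses, every factor of \<open>B\<close>.
  For a factor of prime order \<open>J\<close>, the automorphism group of \<open>J\<close> is abelian, so \<open>D\<close> acts trivially
  on \<open>J\<close> by additive conjugation; hence \<open>d \<mapsto> x * d\<close> is a homomorphism from \<open>D\<close> to \<open>J\<close>,
  and it cannot be onto since \<open>x * d = -x\<close> forces \<open>x = 0\<close>.\<close>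

section \<open>Cosets and cyclic groups\<close>

lemma (in group) l_coset_eq_iff:
  assumes "subgroup K G" "x \<in> carrier G" "y \<in> carrier G"
  shows "x <# K = y <# K \<longleftrightarrow> inv x \<otimes> y \<in> K"
proof
  assume "x <# K = y <# K"
  then have "y \<in> x <# K"
    using lcos_self assms by blast
  then show "inv x \<otimes> y \<in> K"
    using subgroup.lcos_module_imp[OF assms(1) is_group] assms by blast
next
  assume "inv x \<otimes> y \<in> K"
  then have "y \<in> x <# K"
    using subgroup.lcos_module_rev[OF assms(1) is_group] assms by blast
  then show "x <# K = y <# K"
    using l_repr_independence assms by blast
qed

text \<open>Carries the product rule for right cosets over to left cosets, which are the elements of
  \<open>quot_brace\<close>.\<close>

lemma (in normal) lcos_sum:
  assumes "x \<in> carrier G" "y \<in> carrier G"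
  shows "(x <# H) <#> (y <# H) = (x \<otimes> y) <# H"
  using assms rcos_sum[of x y] coset_eq by simp

text \<open>Any non-identity element generates: by Lagrange the order of its span divides a prime
  and is not 1.\<close>

lemma (in group) cyclic_group_of_prime_order:
  assumes "Factorial_Ring.prime (order G)"
  shows "cyclic_group G"
proof -
  have "finite (carrier G)"
    using assms prime_gt_0_nat[of "order G"] order_gt_0_iff_finite by blast
  have "carrier G \<noteq> {\<one>}"
    using assms prime_gt_1_nat[of "order G"] unfolding order_def by auto
  then obtain x where x: "x \<in> carrier G" "x \<noteq> \<one>"
    using one_closed by blast
  have gen: "subgroup (generate G {x}) G"
    using x generate_is_subgroup by simp
  have "card (generate G {x}) dvd order G"
    using lagrange[OF gen] by (metis dvd_triv_right)
  moreover have "card (generate G {x}) \<noteq> 1"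
    using x generate.one[of G "{x}"] generate.incl[of x "{x}" G]
    by (metis card_1_singletonE singletonD singletonI)
  ultimately have "card (generate G {x}) = card (carrier G)"
    using assms prime_nat_iff order_def by metis
  then have "generate G {x} = carrier G"
    using card_subset_eq \<open>finite (carrier G)\<close> subgroup.subset[OF gen] by metis
  then show ?thesis
    using x generate_pow[OF x(1)] unfolding cyclic_group by (auto simp: full_SetCompr_eq)
qed

text \<open>An endomorphism of a cyclic group sends the generator to a power of itself, so it is a
  power map, and power maps commute. In this form the commutativity of the automorphism group of a
  prime-order ideal enters below.\<close>

lemma (in group) hom_commute_of_cyclic:
  assumes "cyclic_group G" "f \<in> hom G G" "g \<in> hom G G" "x \<in> carrier G"
  shows "f (g x) = g (f x)"
proof -
  interpret f: group_hom G G f using assms by unfold_locales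
  interpret g: group_hom G G g using assms by unfold_locales
  obtain z where z: "z \<in> carrier G" "carrier G = range (\<lambda>n::int. z [^] n)"
    using assms(1) cyclic_group by blast
  obtain k l m :: int where "f z = z [^] k" "g z = z [^] l" "x = z [^] m"
    using f.hom_closed[OF z(1)] g.hom_closed[OF z(1)] assms(4) z(2) by (metis rangeE)
  then show ?thesis
    using z(1) by (simp add: f.hom_int_pow g.hom_int_pow int_pow_pow algebra_simps)
qed

section \<open>Elementary identities in a skew brace\<close>

lemma carrier_add_grp [simp]: "carrier (add_grp B) = bcarrier B"
  and carrier_mul_grp [simp]: "carrier (mul_grp B) = bcarrier B"
  and one_add_grp: "one (add_grp B) = bzero B"
  and mult_add_grp: "monoid.mult (add_grp B) = bplus B"
  and mult_mul_grp: "monoid.mult (mul_grp B) = btimes B"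
  by (simp_all add: add_grp_def mul_grp_def)

text \<open>Since \<open>bzero\<close> is defined by description, the unit of a known group
  structure has to be identified with it. This is used where the carrier changes: for homomorphic
  images and sub-braces.\<close>

lemma bzero_eqI:
  assumes "group \<lparr>carrier = bcarrier B, monoid.mult = bplus B, one = e\<rparr>"
  shows "bzero B = e"
proof -
  interpret group "\<lparr>carrier = bcarrier B, monoid.mult = bplus B, one = e\<rparr>" by fact
  have "e \<in> bcarrier B" "\<And>x. x \<in> bcarrier B \<Longrightarrow> bplus B e x = x \<and> bplus B x e = x"
    using one_closed l_one r_one by simp_all
  then show ?thesis
    unfolding bzero_def by (intro the_equality) (blast, metis)
qed

lemma bone_eqI:
  assumes "group \<lparr>carrier = bcarrier B, monoid.mult = btimes B, one = e\<rparr>"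
  shows "bone B = e"
proof -
  interpret group "\<lparr>carrier = bcarrier B, monoid.mult = btimes B, one = e\<rparr>" by fact
  have "e \<in> bcarrier B" "\<And>x. x \<in> bcarrier B \<Longrightarrow> btimes B e x = x \<and> btimes B x e = x"
    using one_closed l_one r_one by simp_all
  then show ?thesis
    unfolding bone_def by (intro the_equality) (blast, metis)
qed

locale skew_brace =
  fixes B :: "'a brace"
  assumes is_brace: "is_brace B"
begin

abbreviation add (infixl "\<boxplus>" 65) where "a \<boxplus> b \<equiv> monoid.mult (add_grp B) a b"
abbreviation times (infixl "\<boxdot>" 70) where "a \<boxdot> b \<equiv> monoid.mult (mul_grp B) a b"
abbreviation neg where "neg a \<equiv> m_inv (add_grp B) a"
abbreviation minv where "minv a \<equiv> m_inv (mul_grp B) a"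
abbreviation zero where "zero \<equiv> one (add_grp B)"
abbreviation lam where "lam \<equiv> blambda B"

sublocale A: group "add_grp B"
  using is_brace by (simp add: is_brace_def)

sublocale M: group "mul_grp B"
  using is_brace by (simp add: is_brace_def)

lemma a_closed [simp, intro]: "a \<in> bcarrier B \<Longrightarrow> b \<in> bcarrier B \<Longrightarrow> a \<boxplus> b \<in> bcarrier B"
  and t_closed [simp, intro]: "a \<in> bcarrier B \<Longrightarrow> b \<in> bcarrier B \<Longrightarrow> a \<boxdot> b \<in> bcarrier B"
  and neg_closed [simp, intro]: "a \<in> bcarrier B \<Longrightarrow> neg a \<in> bcarrier B"
  and minv_closed [simp, intro]: "a \<in> bcarrier B \<Longrightarrow> minv a \<in> bcarrier B"
  and zero_closed [simp, intro]: "zero \<in> bcarrier B"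
  using A.m_closed M.m_closed A.inv_closed M.inv_closed A.one_closed by simp_all

lemma neg_cancel [simp]:
  assumes "a \<in> bcarrier B" "b \<in> bcarrier B"
  shows "neg a \<boxplus> (a \<boxplus> b) = b" "a \<boxplus> (neg a \<boxplus> b) = b"
  using assms by (simp_all flip: A.m_assoc)

lemma minv_cancel [simp]:
  assumes "a \<in> bcarrier B" "b \<in> bcarrier B"
  shows "minv a \<boxdot> (a \<boxdot> b) = b" "a \<boxdot> (minv a \<boxdot> b) = b"
  using assms by (simp_all flip: M.m_assoc)

lemma lam_def: "lam a b = neg a \<boxplus> (a \<boxdot> b)"
  by (simp add: blambda_def bneg_def mult_add_grp mult_mul_grp)

lemma star_def: "bstar B a b = lam a b \<boxplus> neg b"
  by (simp add: bstar_def blambda_def bneg_def mult_add_grp mult_mul_grp)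

lemma lam_closed [simp, intro]: "a \<in> bcarrier B \<Longrightarrow> b \<in> bcarrier B \<Longrightarrow> lam a b \<in> bcarrier B"
  by (simp add: lam_def)

lemma star_closed [simp, intro]:
  "a \<in> bcarrier B \<Longrightarrow> b \<in> bcarrier B \<Longrightarrow> bstar B a b \<in> bcarrier B"
  by (simp add: star_def)

lemma times_eq:
  assumes "a \<in> bcarrier B" "b \<in> bcarrier B"
  shows "a \<boxdot> b = a \<boxplus> lam a b"
  using assms by (simp add: lam_def)

lemma times_add:
  assumes "a \<in> bcarrier B" "b \<in> bcarrier B" "c \<in> bcarrier B"
  shows "a \<boxdot> (b \<boxplus> c) = (a \<boxdot> b) \<boxplus> (neg a \<boxplus> (a \<boxdot> c))"
  using is_brace assms A.m_assoc[of "a \<boxdot> b" "neg a" "a \<boxdot> c"]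
  unfolding is_brace_def bneg_def by (simp flip: mult_add_grp mult_mul_grp)

lemma lam_add:
  assumes "a \<in> bcarrier B" "b \<in> bcarrier B" "c \<in> bcarrier B"
  shows "lam a (b \<boxplus> c) = lam a b \<boxplus> lam a c"
  using assms by (simp add: lam_def times_add A.m_assoc)

lemma lam_hom: "a \<in> bcarrier B \<Longrightarrow> lam a \<in> hom (add_grp B) (add_grp B)"
  by (auto simp: hom_def lam_add)

lemma lam_zero [simp]: "a \<in> bcarrier B \<Longrightarrow> lam a zero = zero"
  using group_hom.hom_one[of "add_grp B" "add_grp B" "lam a"] lam_hom
  by (simp add: group_hom_def group_hom_axioms_def A.is_group)

lemma lam_neg: "a \<in> bcarrier B \<Longrightarrow> b \<in> bcarrier B \<Longrightarrow> lam a (neg b) = neg (lam a b)"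
  using group_hom.hom_inv[of "add_grp B" "add_grp B" "lam a"] lam_hom
  by (simp add: group_hom_def group_hom_axioms_def A.is_group)

text \<open>Each \<open>lam a\<close> fixes zero, so \<open>times_eq\<close> makes zero a right
  identity for multiplication.\<close>

lemma one_eq_zero: "one (mul_grp B) = zero"
proof -
  have "a \<boxdot> zero = a" if "a \<in> bcarrier B" for a
    using times_eq[of a zero] that by simp
  then show ?thesis
    using M.l_one[of zero] M.one_closed by (metis carrier_mul_grp zero_closed)
qed

lemma lam_times:
  assumes "a \<in> bcarrier B" "b \<in> bcarrier B" "c \<in> bcarrier B"
  shows "lam (a \<boxdot> b) c = lam a (lam b c)"
proof -
  \<comment> \<open>Expanding once more gives -(ab) + a - a + a(bc); the middle terms cancel and
    associativity yields \<open>lam (a \<boxdot> b) c\<close>.\<close>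
  have "lam a (lam b c) = neg (lam a b) \<boxplus> lam a (b \<boxdot> c)"
    using assms by (simp add: lam_def[of b c] lam_add lam_neg)
  then show ?thesis
    using assms by (simp add: lam_def A.inv_mult_group A.m_assoc M.m_assoc)
qed

lemma lam_zero_left [simp]: "b \<in> bcarrier B \<Longrightarrow> lam zero b = b"
  using one_eq_zero M.l_one[of b] by (simp add: lam_def)

lemma lam_minv [simp]:
  assumes "a \<in> bcarrier B" "b \<in> bcarrier B"
  shows "lam a (lam (minv a) b) = b" "lam (minv a) (lam a b) = b"
  using assms lam_times[of a "minv a" b] lam_times[of "minv a" a b] one_eq_zero by simp_all

text \<open>Solve 0 = a^{-1} a = a^{-1} + lambda_{a^{-1}}(a) for the first summand. The formula
  turns closure under negation and lambda into closure under multiplicative inverses.\<close>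

lemma minv_eq: "a \<in> bcarrier B \<Longrightarrow> minv a = lam (minv a) (neg a)"
  using times_eq[of "minv a" a] one_eq_zero lam_neg[of "minv a" a]
  by (simp add: A.inv_equality)

section \<open>Ideals of a brace\<close>

lemma brace_idealD:
  assumes "brace_ideal I B"
  shows "subgroup I (add_grp B)" "subgroup I (mul_grp B)" "I \<subseteq> bcarrier B"
    and "normal I (add_grp B)" "normal I (mul_grp B)"
    and "\<And>a x. a \<in> bcarrier B \<Longrightarrow> x \<in> I \<Longrightarrow> lam a x \<in> I"
    and "\<And>a x. a \<in> bcarrier B \<Longrightarrow> x \<in> I \<Longrightarrow> a \<boxplus> x \<boxplus> neg a \<in> I"
    and "\<And>a x. a \<in> bcarrier B \<Longrightarrow> x \<in> I \<Longrightarrow> a \<boxdot> x \<boxdot> minv a \<in> I"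
  using assms subgroup.subset[of I "add_grp B"] normal.inv_op_closed2[of I "add_grp B"]
    normal.inv_op_closed2[of I "mul_grp B"]
  unfolding brace_ideal_def by auto

text \<open>By \<open>times_eq\<close> and \<open>minv_eq\<close>, a lambda-invariant additive
  subgroup is also a multiplicative subgroup, so beyond that only the two kinds of conjugation
  remain to be checked.\<close>

lemma brace_idealI:
  assumes "subgroup I (add_grp B)"
    and lam: "\<And>a x. a \<in> bcarrier B \<Longrightarrow> x \<in> I \<Longrightarrow> lam a x \<in> I"
    and "\<And>a x. a \<in> bcarrier B \<Longrightarrow> x \<in> I \<Longrightarrow> a \<boxplus> x \<boxplus> neg a \<in> I"
    and "\<And>a x. a \<in> bcarrier B \<Longrightarrow> x \<in> I \<Longrightarrow> a \<boxdot> x \<boxdot> minv a \<in> I"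
  shows "brace_ideal I B"
proof -
  have sub: "I \<subseteq> bcarrier B"
    using subgroup.subset[OF assms(1)] by simp
  have "subgroup I (mul_grp B)"
  proof (rule M.subgroupI)
    show "I \<subseteq> carrier (mul_grp B)" "I \<noteq> {}"
      using sub subgroup.one_closed[OF assms(1)] by auto
    show "minv a \<in> I" if "a \<in> I" for a
      using minv_eq[of a] lam[of "minv a" "neg a"] subgroup.m_inv_closed[OF assms(1) that] sub that
      by auto
    show "a \<boxdot> b \<in> I" if "a \<in> I" "b \<in> I" for a b
    proof -
      have ab: "a \<in> bcarrier B" "b \<in> bcarrier B" using sub that by auto
      then show ?thesis
        using times_eq[OF ab] lam[of a b] subgroup.m_closed[OF assms(1)] that by simp
    qed
  qed
  then show ?thesis
    using assms unfolding brace_ideal_def by (simp add: A.normal_inv_iff M.normal_inv_iff)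
qed

text \<open>Writing xb = b(b^{-1}xb) and applying \<open>times_eq\<close> gives xb = b + y with y in
  \<open>J\<close>. Hence -x + xb - b is -x plus the additive conjugate of y by b.\<close>

lemma star_in_ideal:
  assumes "brace_ideal J B" "x \<in> J" "b \<in> bcarrier B"
  shows "bstar B x b \<in> J"
proof -
  note J = brace_idealD[OF assms(1)]
  let ?y = "lam b (minv b \<boxdot> x \<boxdot> b)"
  have x: "x \<in> bcarrier B" using assms J by blast
  have "minv b \<boxdot> x \<boxdot> b \<in> J"
    using J(8)[of "minv b" x] assms by simp
  then have y: "?y \<in> J" using J(6) assms by blast
  have "x \<boxdot> b = b \<boxplus> ?y"
    using assms x by (simp add: M.m_assoc flip: times_eq)
  then have "bstar B x b = neg x \<boxplus> (b \<boxplus> ?y \<boxplus> neg b)"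
    using assms x by (simp add: star_def lam_def A.m_assoc)
  then show ?thesis
    using J(1,7) y assms by (simp add: subgroup.m_closed subgroup.m_inv_closed)
qed


section \<open>The derived ideal\<close>

lemma
  shows subgroup_bderived: "subgroup (bderived B) (add_grp B)"
    and bderived_subset: "bderived B \<subseteq> bcarrier B"
    and star_in_bderived: "a \<in> bcarrier B \<Longrightarrow> b \<in> bcarrier B \<Longrightarrow> bstar B a b \<in> bderived B"
    and commutator_in_bderived:
      "a \<in> bcarrier B \<Longrightarrow> b \<in> bcarrier B \<Longrightarrow> a \<boxplus> b \<boxplus> neg a \<boxplus> neg b \<in> bderived B"
    and bderived_least:
      "subgroup H (add_grp B) \<Longrightarrow>
       (\<And>a b. a \<in> bcarrier B \<Longrightarrow> b \<in> bcarrier B \<Longrightarrow> bstar B a b \<in> H) \<Longrightarrow>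
       (\<And>a b. a \<in> bcarrier B \<Longrightarrow> b \<in> bcarrier B \<Longrightarrow> a \<boxplus> b \<boxplus> neg a \<boxplus> neg b \<in> H) \<Longrightarrow>
       bderived B \<subseteq> H"
proof -
  let ?S = "{bstar B a b | a b. a \<in> bcarrier B \<and> b \<in> bcarrier B}"
  have S: "?S \<subseteq> carrier (add_grp B)"
    by (auto simp: star_def)
  have T: "derived (add_grp B) (bcarrier B) \<subseteq> carrier (add_grp B)"
    using A.derived_in_carrier[of "bcarrier B"] by simp
  have U: "bstar_set B \<union> derived (add_grp B) (bcarrier B) \<subseteq> carrier (add_grp B)"
    unfolding bstar_set_def using A.generate_in_carrier[OF S] T by blast
  show D: "subgroup (bderived B) (add_grp B)"
    unfolding bderived_def by (rule A.generate_is_subgroup[OF U])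
  show "bderived B \<subseteq> bcarrier B"
    using subgroup.subset[OF D] by simp
  show "bstar B a b \<in> bderived B" if "a \<in> bcarrier B" "b \<in> bcarrier B"
    unfolding bderived_def bstar_set_def using that by (blast intro: generate.incl)
  show "a \<boxplus> b \<boxplus> neg a \<boxplus> neg b \<in> bderived B" if "a \<in> bcarrier B" "b \<in> bcarrier B"
    unfolding bderived_def derived_def using that by (blast intro: generate.incl)
  show "bderived B \<subseteq> H"
    if H: "subgroup H (add_grp B)"
      "\<And>a b. a \<in> bcarrier B \<Longrightarrow> b \<in> bcarrier B \<Longrightarrow> bstar B a b \<in> H"
      "\<And>a b. a \<in> bcarrier B \<Longrightarrow> b \<in> bcarrier B \<Longrightarrow> a \<boxplus> b \<boxplus> neg a \<boxplus> neg b \<in> H"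
  proof -
    have "bstar_set B \<subseteq> H"
      unfolding bstar_set_def using A.generate_subgroup_incl[of ?S H] H by blast
    moreover have "derived (add_grp B) (bcarrier B) \<subseteq> H"
      unfolding derived_def using A.generate_subgroup_incl[of "derived_set (add_grp B) (bcarrier B)" H] H
      by blast
    ultimately show ?thesis
      unfolding bderived_def using A.generate_subgroup_incl H(1) by blast
  qed
qed

text \<open>Together with \<open>minv_eq\<close> this makes the derived ideal closed under
  multiplicative inverses, hence a sub-brace.\<close>

lemma lam_bderived:
  assumes "a \<in> bcarrier B" "d \<in> bderived B"
  shows "lam a d \<in> bderived B"
proof -
  have "d \<in> bcarrier B" using assms bderived_subset by blast
  then have "lam a d = bstar B a d \<boxplus> d"
    using assms by (simp add: star_def A.m_assoc)
  then show ?thesis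
    using assms \<open>d \<in> bcarrier B\<close> star_in_bderived subgroup.m_closed[OF subgroup_bderived] by simp
qed

section \<open>The derived ideal and ideals of prime order\<close>

abbreviation conj where "conj a x \<equiv> a \<boxplus> x \<boxplus> neg a"

lemma conj_add:
  assumes "a \<in> bcarrier B" "b \<in> bcarrier B" "x \<in> bcarrier B"
  shows "conj (a \<boxplus> b) x = conj a (conj b x)"
  using assms by (simp add: A.inv_mult_group A.m_assoc)

lemma conj_neg:
  assumes "a \<in> bcarrier B" "x \<in> bcarrier B"
  shows "conj (neg a) (conj a x) = x" "conj a (conj (neg a) x) = x"
  using assms by (simp_all add: A.m_assoc)

lemma lam_conj:
  assumes "a \<in> bcarrier B" "b \<in> bcarrier B" "x \<in> bcarrier B"
  shows "lam a (conj b x) = conj (lam a b) (lam a x)"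
  using assms by (simp add: lam_add lam_neg)

text \<open>A commutator acts on \<open>J\<close> as a commutator of automorphisms, and \<open>conj (lam a b)\<close> is the
  \<open>lam a\<close>-conjugate of \<open>conj b\<close>, so both kinds of generators act trivially.\<close>

lemma bderived_centralizes:
  assumes J: "brace_ideal J B" and p: "Factorial_Ring.prime (card J)"
    and "d \<in> bderived B" "x \<in> J"
  shows "conj d x = x"
proof -
  note JD = brace_idealD[OF J]
  let ?G = "(add_grp B)\<lparr>carrier := J\<rparr>"
  interpret G: group ?G
    using A.subgroup_imp_group[OF JD(1)] .
  have cyc: "cyclic_group ?G"
    using G.cyclic_group_of_prime_order p by (simp add: order_def)
  have lamG: "lam a \<in> hom ?G ?G" if "a \<in> bcarrier B" for a
    using that JD(3,6) by (auto simp: hom_def subset_iff lam_add)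
  have conjG: "conj a \<in> hom ?G ?G" if "a \<in> bcarrier B" for a
    using that JD(3,7) by (auto simp: hom_def subset_iff A.m_assoc)
  have commute: "f (g y) = g (f y)" if "f \<in> hom ?G ?G" "g \<in> hom ?G ?G" "y \<in> J" for f g y
    using G.hom_commute_of_cyclic[OF cyc that(1,2)] that(3) by simp
  let ?H = "{c \<in> bcarrier B. \<forall>x\<in>J. conj c x = x}"
  have "subgroup ?H (add_grp B)"
  proof (rule A.subgroupI)
    show "?H \<subseteq> carrier (add_grp B)" by auto
    have "zero \<in> ?H" using JD(3) by (auto simp: subset_iff)
    then show "?H \<noteq> {}" by blast
    show "neg a \<in> ?H" if "a \<in> ?H" for a
    proof -
      have "conj (neg a) x = x" if "x \<in> J" for x
        using conj_neg(1)[of a x] \<open>a \<in> ?H\<close> that JD(3) by auto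
      then show ?thesis using that by simp
    qed
    show "a \<boxplus> b \<in> ?H" if "a \<in> ?H" "b \<in> ?H" for a b
    proof -
      have "conj (a \<boxplus> b) x = x" if "x \<in> J" for x
        using conj_add[of a b x] \<open>a \<in> ?H\<close> \<open>b \<in> ?H\<close> that JD(3) by auto
      then show ?thesis using that by simp
    qed
  qed
  moreover have "bstar B a b \<in> ?H" if ab: "a \<in> bcarrier B" "b \<in> bcarrier B" for a b
  proof -
    have *: "conj (lam a b) y = conj b y" if y: "y \<in> J" for y
    proof -
      have yB: "y \<in> bcarrier B" using y JD(3) by blast
      have "conj (lam a b) y = lam a (conj b (lam (minv a) y))"
        using ab yB by (simp add: lam_conj)
      also have "\<dots> = lam a (lam (minv a) (conj b y))"
        using commute[OF conjG lamG y, of b "minv a"] ab by simp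
      finally show ?thesis using ab yB by simp
    qed
    have "conj (bstar B a b) y = y" if y: "y \<in> J" for y
    proof -
      have yB: "y \<in> bcarrier B" using y JD(3) by blast
      have "conj (bstar B a b) y = conj (lam a b) (conj (neg b) y)"
        using ab yB by (simp add: star_def conj_add del: A.inv_inv)
      also have "\<dots> = conj b (conj (neg b) y)"
        using *[of "conj (neg b) y"] JD(7)[of "neg b" y] ab y by simp
      finally show ?thesis using conj_neg(2)[of b y] ab yB by simp
    qed
    then show ?thesis using ab by (simp add: star_def)
  qed
  moreover have "a \<boxplus> b \<boxplus> neg a \<boxplus> neg b \<in> ?H" if ab: "a \<in> bcarrier B" "b \<in> bcarrier B" for a b
  proof -
    have "conj (a \<boxplus> b \<boxplus> neg a \<boxplus> neg b) y = y" if y: "y \<in> J" for y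
    proof -
      have yB: "y \<in> bcarrier B" using y JD(3) by blast
      have yJ: "conj (neg b) y \<in> J" using JD(7)[of "neg b" y] ab y by blast
      have "conj (a \<boxplus> b \<boxplus> neg a \<boxplus> neg b) y = conj a (conj b (conj (neg a) (conj (neg b) y)))"
        using ab yB conj_add[of "a \<boxplus> b \<boxplus> neg a" "neg b" y] conj_add[of "a \<boxplus> b" "neg a"]
          conj_add[of a b] by (simp del: A.inv_inv)
      also have "\<dots> = conj a (conj (neg a) (conj b (conj (neg b) y)))"
        using commute[OF conjG conjG yJ, of b "neg a"] ab by (simp del: A.inv_inv)
      also have "\<dots> = y"
        using conj_neg(2)[of b y] conj_neg(2)[of a y] ab yB by (simp del: A.inv_inv)
      finally show ?thesis .
    qed
    then show ?thesis using ab by simp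
  qed
  ultimately have "bderived B \<subseteq> ?H" by (rule bderived_least)
  then show ?thesis using assms(3,4) by blast
qed

lemma lam_prime_ideal_bderived:
  assumes J: "brace_ideal J B" and p: "Factorial_Ring.prime (card J)"
    and d: "d \<in> bderived B" and x: "x \<in> J"
  shows "lam x d = d"
proof -
  note JD = brace_idealD[OF J]
  let ?f = "bstar B x"
  let ?G = "(add_grp B)\<lparr>carrier := J\<rparr>" and ?D = "(add_grp B)\<lparr>carrier := bderived B\<rparr>"
  interpret G: group ?G
    using A.subgroup_imp_group[OF JD(1)] .
  interpret D: group ?D
    using A.subgroup_imp_group[OF subgroup_bderived] .
  have xB: "x \<in> bcarrier B" using x JD(3) by blast
  have DB: "\<And>b. b \<in> bderived B \<Longrightarrow> b \<in> bcarrier B" using bderived_subset by blast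
  \<comment> \<open>In general x * (b + c) = x * b + (b + x * c - b). The conjugation by
    \<open>b\<close> disappears because x * c lies in \<open>J\<close>, which \<open>b\<close>
    centralizes.\<close>
  have "?f (b \<boxplus> c) = ?f b \<boxplus> ?f c" if bc: "b \<in> bderived B" "c \<in> bderived B" for b c
  proof -
    have fc: "?f c \<in> J" using star_in_ideal[OF J x] DB bc by blast
    then have fcB: "?f c \<in> bcarrier B" using JD(3) by blast
    have "?f (b \<boxplus> c) = ?f b \<boxplus> conj b (?f c)"
      using xB DB bc by (simp add: star_def lam_add A.inv_mult_group A.m_assoc)
    then show ?thesis
      using bderived_centralizes[OF J p bc(1) fc] by simp
  qed
  then have "?f \<in> hom ?D ?G"
    using star_in_ideal[OF J x] DB by (auto simp: hom_def)
  then interpret f: group_hom ?D ?G ?f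
    by unfold_locales
  have sub: "subgroup (?f ` bderived B) ?G"
    using f.img_is_subgroup by simp
  have subJ: "?f ` bderived B \<subseteq> J"
    using subgroup.subset[OF sub] by simp
  have "card (?f ` bderived B) dvd card J"
  proof -
    have "card (rcosets\<^bsub>?G\<^esub> (?f ` bderived B)) * card (?f ` bderived B) = card J"
      using G.lagrange[OF sub] by (simp add: order_def)
    then show ?thesis by (metis dvd_triv_right)
  qed
  then consider "card (?f ` bderived B) = 1" | "card (?f ` bderived B) = card J"
    using p prime_nat_iff by blast
  then show ?thesis
  proof cases
    case 1
    moreover have "zero \<in> ?f ` bderived B"
      using subgroup.one_closed[OF sub] by simp
    ultimately have "?f d = zero"
      using d by (metis card_1_singletonE imageI singletonD)
    then show ?thesis
      using A.inv_equality[of "lam x d" "neg d"] xB DB d by (simp add: star_def)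
  next
    \<comment> \<open>An onto map would reach \<open>neg x\<close>. From -x + xc - c = -x follows xc
      = c, so \<open>x\<close> is the identity; the goal then holds directly, because lambda of zero
      is trivial.\<close>
    case 2
    have "finite J" using p card_ge_0_finite prime_gt_0_nat by blast
    then have "?f ` bderived B = J"
      using card_subset_eq subJ 2 by blast
    moreover have "neg x \<in> J"
      using subgroup.m_inv_closed[OF JD(1) x] .
    ultimately obtain c where c: "c \<in> bderived B" "?f c = neg x"
      by (metis imageE)
    then have cB: "c \<in> bcarrier B" using DB by blast
    have "lam x c = neg x \<boxplus> c"
      using c(2) cB xB by (metis A.inv_solve_right' carrier_add_grp lam_closed neg_closed star_def)
    then have "x \<boxdot> c = c"
      using times_eq[of x c] xB cB by simp
    then have "x = zero"
      using xB cB M.r_cancel_one' one_eq_zero by (metis M.r_cancel_one carrier_mul_grp)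
    then show ?thesis using DB d by simp
  qed
qed

section \<open>The socle is an ideal\<close>

lemma bsocD:
  assumes "a \<in> bsoc B"
  shows "a \<in> bcarrier B" "\<And>b. b \<in> bcarrier B \<Longrightarrow> lam a b = b"
    "\<And>b. b \<in> bcarrier B \<Longrightarrow> a \<boxplus> b = b \<boxplus> a"
  using assms unfolding bsoc_def mult_add_grp by auto

lemma bsocI:
  assumes "a \<in> bcarrier B" "\<And>b. b \<in> bcarrier B \<Longrightarrow> lam a b = b"
    "\<And>b. b \<in> bcarrier B \<Longrightarrow> a \<boxplus> b = b \<boxplus> a"
  shows "a \<in> bsoc B"
  using assms unfolding bsoc_def mult_add_grp by auto

lemma bsoc_times:
  assumes "a \<in> bsoc B" "b \<in> bcarrier B"
  shows "a \<boxdot> b = a \<boxplus> b"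
  using assms by (simp add: bsocD times_eq)

text \<open>Applying \<open>lam c\<close> to the centrality of \<open>a\<close> shows that
  \<open>lam c a\<close> is central. The conjugate y = cac^{-1} acts trivially through lambda, so y
  + c = yc = ca = c + \<open>lam c a\<close> = \<open>lam c a\<close> + c. Cancelling
  \<open>c\<close> identifies the two elements, which thus share both properties.\<close>

lemma lam_bsoc:
  assumes c: "c \<in> bcarrier B" and a: "a \<in> bsoc B"
  shows "lam c a \<in> bsoc B" "c \<boxdot> a \<boxdot> minv c = lam c a"
proof -
  note aS = bsocD[OF a]
  let ?y = "c \<boxdot> a \<boxdot> minv c"
  have central: "lam c a \<boxplus> b = b \<boxplus> lam c a" if "b \<in> bcarrier B" for b
  proof -
    have "lam c (a \<boxplus> lam (minv c) b) = lam c (lam (minv c) b \<boxplus> a)"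
      using aS(3)[of "lam (minv c) b"] that c by simp
    then show ?thesis using that c aS(1) by (simp add: lam_add)
  qed
  have lam_y: "lam ?y b = b" if "b \<in> bcarrier B" for b
    using that c aS by (simp add: lam_times)
  have "?y \<boxplus> c = ?y \<boxdot> c"
    using c aS(1) by (simp add: times_eq[of ?y c] lam_y)
  also have "\<dots> = lam c a \<boxplus> c"
    using c aS(1) central[of c] by (simp add: M.m_assoc flip: times_eq)
  finally show y: "?y = lam c a"
    using c aS(1) by simp
  show "lam c a \<in> bsoc B"
    using c aS(1) central lam_y unfolding y by (intro bsocI) auto
qed

lemma bsoc_ideal: "brace_ideal (bsoc B) B"
proof (rule brace_idealI)
  show "subgroup (bsoc B) (add_grp B)"
  proof (rule A.subgroupI)
    show "bsoc B \<subseteq> carrier (add_grp B)" using bsocD by auto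
    have "zero \<in> bsoc B" by (rule bsocI) auto
    then show "bsoc B \<noteq> {}" by blast
    show "neg a \<in> bsoc B" if a: "a \<in> bsoc B" for a
    proof (rule bsocI)
      note aS = bsocD[OF a]
      show "neg a \<in> bcarrier B" using aS by blast
      \<comment> \<open>On the socle both operations agree, so \<open>neg a\<close> is the
        multiplicative inverse of \<open>a\<close> and its lambda map inverts the identity.\<close>
      have "a \<boxdot> neg a = zero" using bsoc_times[OF a] aS(1) by simp
      then have "lam a (lam (neg a) b) = b" if "b \<in> bcarrier B" for b
        using lam_times[of a "neg a" b] aS(1) that by simp
      then show "lam (neg a) b = b" if "b \<in> bcarrier B" for b
        using aS that by (metis lam_closed neg_closed)
      show "neg a \<boxplus> b = b \<boxplus> neg a" if "b \<in> bcarrier B" for b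
      proof -
        have "neg a \<boxplus> b = neg a \<boxplus> (b \<boxplus> a) \<boxplus> neg a"
          using aS(1) that by (simp add: A.m_assoc)
        then show ?thesis using aS(1) aS(3)[OF that, symmetric] that by simp
      qed
    qed
    show "a \<boxplus> b \<in> bsoc B" if a: "a \<in> bsoc B" and b: "b \<in> bsoc B" for a b
    proof (rule bsocI)
      note aS = bsocD[OF a] and bS = bsocD[OF b]
      show "a \<boxplus> b \<in> bcarrier B" using aS bS by blast
      show "lam (a \<boxplus> b) c = c" if "c \<in> bcarrier B" for c
        using lam_times[of a b c] bsoc_times[OF a bS(1)] aS(1,2) bS(1,2) that by simp
      show "(a \<boxplus> b) \<boxplus> c = c \<boxplus> (a \<boxplus> b)" if "c \<in> bcarrier B" for c
        using aS bS that by (metis A.m_assoc carrier_add_grp)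
    qed
  qed
  show "lam a x \<in> bsoc B" "a \<boxdot> x \<boxdot> minv a \<in> bsoc B"
    if "a \<in> bcarrier B" "x \<in> bsoc B" for a x
    using lam_bsoc[OF that] by simp_all
  show "a \<boxplus> x \<boxplus> neg a \<in> bsoc B" if "a \<in> bcarrier B" "x \<in> bsoc B" for a x
    using bsocD[OF that(2)] that by (simp add: A.m_assoc flip: bsocD(3)[OF that(2)])
qed

lemma zero_ideal: "brace_ideal {zero} B"
proof (rule brace_idealI)
  show "subgroup {zero} (add_grp B)" by (rule A.triv_subgroup)
qed (auto simp: one_eq_zero M.r_inv[unfolded one_eq_zero] M.r_one[unfolded one_eq_zero])

end


section \<open>Surjective brace homomorphisms\<close>

text \<open>The brace axioms for \<open>C\<close> are consequences: surjectivity transports the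
  group laws and the distributive law. A quotient is therefore shown to be a brace by checking that
  the coset map respects both operations.\<close>

locale brace_epi = B: skew_brace B for B :: "'a brace" +
  fixes C :: "'b brace" and h :: "'a \<Rightarrow> 'b"
  assumes surj: "bcarrier C = h ` bcarrier B"
    and h_plus: "x \<in> bcarrier B \<Longrightarrow> y \<in> bcarrier B \<Longrightarrow> h (bplus B x y) = bplus C (h x) (h y)"
    and h_times: "x \<in> bcarrier B \<Longrightarrow> y \<in> bcarrier B \<Longrightarrow> h (btimes B x y) = btimes C (h x) (h y)"
begin

lemma group_add_grp: "group (add_grp C)"
  and group_mul_grp: "group (mul_grp C)"
proof -
  have "h \<in> hom (add_grp B) (add_grp C)"
    using surj h_plus by (auto simp: hom_def mult_add_grp)
  from B.A.hom_imp_img_group[OF this]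
  have "group \<lparr>carrier = bcarrier C, monoid.mult = bplus C, one = h \<one>\<^bsub>add_grp B\<^esub>\<rparr>"
    by (simp add: surj add_grp_def)
  with bzero_eqI[OF this] show "group (add_grp C)"
    by (simp add: add_grp_def)
  have "h \<in> hom (mul_grp B) (mul_grp C)"
    using surj h_times by (auto simp: hom_def mult_mul_grp)
  from B.M.hom_imp_img_group[OF this]
  have "group \<lparr>carrier = bcarrier C, monoid.mult = btimes C, one = h \<one>\<^bsub>mul_grp B\<^esub>\<rparr>"
    by (simp add: surj mul_grp_def)
  with bone_eqI[OF this] show "group (mul_grp C)"
    by (simp add: mul_grp_def)
qed

sublocale hA: group_hom "add_grp B" "add_grp C" h
  using group_add_grp surj h_plus
  by (auto simp: group_hom_def group_hom_axioms_def hom_def mult_add_grp)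

sublocale hM: group_hom "mul_grp B" "mul_grp C" h
  using group_mul_grp surj h_times
  by (auto simp: group_hom_def group_hom_axioms_def hom_def mult_mul_grp)

sublocale C: skew_brace C
proof
  have "btimes C (h a) (bplus C (h b) (h c)) =
      bplus C (bplus C (btimes C (h a) (h b)) (bneg C (h a))) (btimes C (h a) (h c))"
    if abc: "a \<in> bcarrier B" "b \<in> bcarrier B" "c \<in> bcarrier B" for a b c
  proof -
    have "btimes B a (bplus B b c) = bplus B (bplus B (btimes B a b) (bneg B a)) (btimes B a c)"
      using B.is_brace abc unfolding is_brace_def by blast
    from arg_cong[OF this, of h] show ?thesis
      using abc hA.hom_mult hM.hom_mult hA.hom_inv unfolding bneg_def
      by (simp flip: mult_add_grp mult_mul_grp)
  qed
  then show "is_brace C"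
    unfolding is_brace_def surj using group_add_grp group_mul_grp by blast
qed

lemma h_closed [simp, intro]: "x \<in> bcarrier B \<Longrightarrow> h x \<in> bcarrier C"
  using surj by blast

lemma h_lam: "a \<in> bcarrier B \<Longrightarrow> b \<in> bcarrier B \<Longrightarrow> h (blambda B a b) = blambda C (h a) (h b)"
  by (simp add: B.lam_def C.lam_def)

lemma h_star: "a \<in> bcarrier B \<Longrightarrow> b \<in> bcarrier B \<Longrightarrow> h (bstar B a b) = bstar C (h a) (h b)"
  by (simp add: B.star_def C.star_def h_lam)

lemma subgroup_preimage:
  assumes "subgroup H (add_grp C)"
  shows "subgroup {x \<in> bcarrier B. h x \<in> H} (add_grp B)"
proof (rule B.A.subgroupI)
  have "\<one>\<^bsub>add_grp B\<^esub> \<in> {x \<in> bcarrier B. h x \<in> H}"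
    using subgroup.one_closed[OF assms] by auto
  then show "{x \<in> bcarrier B. h x \<in> H} \<noteq> {}" by blast
qed (auto simp: subgroup.m_closed[OF assms] subgroup.m_inv_closed[OF assms])

text \<open>Applied to the socle of a quotient, this lifts the ideal property to the next socle
  term.\<close>

lemma ideal_preimage:
  assumes "brace_ideal J C"
  shows "brace_ideal {x \<in> bcarrier B. h x \<in> J} B"
  using subgroup_preimage C.brace_idealD[OF assms]
  by (intro B.brace_idealI) (auto simp: h_lam)

text \<open>Applied to a coset map, this turns a prime-order factor of the chain into a prime-order
  ideal of a quotient.\<close>

lemma ideal_image:
  assumes "brace_ideal I B"
  shows "brace_ideal (h ` I) C"
proof -
  note I = B.brace_idealD[OF assms]
  have "h b \<otimes>\<^bsub>add_grp C\<^esub> h x \<otimes>\<^bsub>add_grp C\<^esub> inv\<^bsub>add_grp C\<^esub> h b \<in> h ` I"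
    "h b \<otimes>\<^bsub>mul_grp C\<^esub> h x \<otimes>\<^bsub>mul_grp C\<^esub> inv\<^bsub>mul_grp C\<^esub> h b \<in> h ` I"
    "blambda C (h b) (h x) \<in> h ` I"
    if "b \<in> bcarrier B" "x \<in> I" for b x
  proof -
    have "x \<in> bcarrier B" using that I(3) by blast
    then show "h b \<otimes>\<^bsub>add_grp C\<^esub> h x \<otimes>\<^bsub>add_grp C\<^esub> inv\<^bsub>add_grp C\<^esub> h b \<in> h ` I"
      "h b \<otimes>\<^bsub>mul_grp C\<^esub> h x \<otimes>\<^bsub>mul_grp C\<^esub> inv\<^bsub>mul_grp C\<^esub> h b \<in> h ` I"
      "blambda C (h b) (h x) \<in> h ` I"
      using imageI[OF I(7)[OF that], of h] imageI[OF I(8)[OF that], of h]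
        imageI[OF I(6)[OF that], of h] that h_lam by simp_all
  qed
  then show ?thesis
    using hA.subgroup_img_is_subgroup[OF I(1)] surj by (intro C.brace_idealI) auto
qed

text \<open>The preimage of the derived ideal of \<open>C\<close> is an additive subgroup containing
  all generators of that of \<open>B\<close>.\<close>

lemma bderived_image: "h ` bderived B \<subseteq> bderived C"
proof -
  have "bderived B \<subseteq> {x \<in> bcarrier B. h x \<in> bderived C}"
    using C.star_in_bderived C.commutator_in_bderived
    by (intro B.bderived_least subgroup_preimage C.subgroup_bderived)
       (auto simp: h_star)
  then show ?thesis by blast
qed

end

section \<open>Quotient braces and the socle series\<close>

context skew_brace
begin

lemma quot_epi:
  assumes "brace_ideal K B"
  shows "brace_epi B (quot_brace B K) (\<lambda>a. a <#\<^bsub>add_grp B\<^esub> K)"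
proof unfold_locales
  note K = brace_idealD[OF assms]
  \<comment> \<open>Additive and multiplicative cosets coincide: aK = a + lambda_a(K), and
    \<open>lam a\<close> maps \<open>K\<close> onto itself because \<open>lam (minv a)\<close> also
    preserves it. The product of cosets can then be computed in the multiplicative group.\<close>
  have eq: "a <#\<^bsub>add_grp B\<^esub> K = a <#\<^bsub>mul_grp B\<^esub> K" if a: "a \<in> bcarrier B" for a
  proof -
    have "lam a ` K = K"
    proof
      show "lam a ` K \<subseteq> K" using K(6) a by blast
      show "K \<subseteq> lam a ` K"
      proof
        fix k assume k: "k \<in> K"
        then have "k = lam a (lam (minv a) k)" "lam (minv a) k \<in> K"
          using K(3) K(6)[of "minv a" k] a by auto
        then show "k \<in> lam a ` K" by blast
      qed
    qed
    then have "a <#\<^bsub>add_grp B\<^esub> K = (\<Union>k\<in>lam a ` K. {a \<boxplus> k})"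
      by (simp only: l_coset_def)
    also have "\<dots> = (\<Union>k\<in>K. {a \<boxplus> lam a k})"
      by simp
    also have "\<dots> = (\<Union>k\<in>K. {a \<boxdot> k})"
      using times_eq[OF a] K(3) by (intro SUP_cong refl) (simp add: subset_iff)
    finally show ?thesis
      by (simp only: l_coset_def)
  qed
  show "bcarrier (quot_brace B K) = (\<lambda>a. a <#\<^bsub>add_grp B\<^esub> K) ` bcarrier B"
    by (auto simp: quot_brace_def)
  show "bplus B x y <#\<^bsub>add_grp B\<^esub> K =
      bplus (quot_brace B K) (x <#\<^bsub>add_grp B\<^esub> K) (y <#\<^bsub>add_grp B\<^esub> K)"
    if "x \<in> bcarrier B" "y \<in> bcarrier B" for x y
    using normal.lcos_sum[OF K(4)] that by (simp add: quot_brace_def mult_add_grp)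
  show "btimes B x y <#\<^bsub>add_grp B\<^esub> K =
      btimes (quot_brace B K) (x <#\<^bsub>add_grp B\<^esub> K) (y <#\<^bsub>add_grp B\<^esub> K)"
    if "x \<in> bcarrier B" "y \<in> bcarrier B" for x y
    using normal.lcos_sum[OF K(5), of x y] t_closed[OF that] that
    by (simp add: quot_brace_def mult_mul_grp eq)
qed

text \<open>Each term is the preimage of the socle of a quotient, and that quotient is known to be a
  brace once the previous term is an ideal.\<close>

lemma bsocn_ideal: "brace_ideal (bsocn B k) B"
proof (induction k)
  case 0
  then show ?case using zero_ideal by (simp add: one_add_grp)
next
  case (Suc k)
  interpret q: brace_epi B "quot_brace B (bsocn B k)" "\<lambda>a. a <#\<^bsub>add_grp B\<^esub> bsocn B k"
    using quot_epi[OF Suc] .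
  show ?case using q.ideal_preimage[OF q.C.bsoc_ideal] by simp
qed

text \<open>Equality of cosets becomes membership of a difference, which removes the quotient from
  the definition. The final induction can then argue with elements alone.\<close>

lemma mem_bsocn_Suc:
  "a \<in> bsocn B (Suc k) \<longleftrightarrow> a \<in> bcarrier B \<and>
    (\<forall>b\<in>bcarrier B. neg (lam a b) \<boxplus> b \<in> bsocn B k \<and> neg (a \<boxplus> b) \<boxplus> (b \<boxplus> a) \<in> bsocn B k)"
proof -
  interpret q: brace_epi B "quot_brace B (bsocn B k)" "\<lambda>a. a <#\<^bsub>add_grp B\<^esub> bsocn B k"
    using quot_epi[OF bsocn_ideal] .
  have sub: "subgroup (bsocn B k) (add_grp B)"
    using brace_idealD(1)[OF bsocn_ideal] .
  have eq: "x <#\<^bsub>add_grp B\<^esub> bsocn B k = y <#\<^bsub>add_grp B\<^esub> bsocn B k \<longleftrightarrow> neg x \<boxplus> y \<in> bsocn B k"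
    if "x \<in> bcarrier B" "y \<in> bcarrier B" for x y
    using A.l_coset_eq_iff[OF sub] that by simp
  have "blambda (quot_brace B (bsocn B k)) (a <#\<^bsub>add_grp B\<^esub> bsocn B k)
        (b <#\<^bsub>add_grp B\<^esub> bsocn B k) = b <#\<^bsub>add_grp B\<^esub> bsocn B k \<longleftrightarrow>
      neg (lam a b) \<boxplus> b \<in> bsocn B k"
    if "a \<in> bcarrier B" "b \<in> bcarrier B" for b
    using eq[OF lam_closed, OF that that(2)] unfolding q.h_lam[OF that] .
  moreover have "bplus (quot_brace B (bsocn B k)) (a <#\<^bsub>add_grp B\<^esub> bsocn B k)
        (b <#\<^bsub>add_grp B\<^esub> bsocn B k) =
      bplus (quot_brace B (bsocn B k)) (b <#\<^bsub>add_grp B\<^esub> bsocn B k)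
        (a <#\<^bsub>add_grp B\<^esub> bsocn B k) \<longleftrightarrow>
      neg (a \<boxplus> b) \<boxplus> (b \<boxplus> a) \<in> bsocn B k"
    if "a \<in> bcarrier B" "b \<in> bcarrier B" for b
    using eq[OF a_closed a_closed, OF that that(2,1)]
    unfolding mult_add_grp q.h_plus[OF that] q.h_plus[OF that(2,1)] .
  ultimately show ?thesis
    unfolding bsocn.simps bsoc_def mem_Collect_eq q.surj ball_simps
    by (metis (no_types, lifting) imageI)
qed

section \<open>Sub-braces\<close>

lemma
  assumes D: "subgroup D (add_grp B)" and lam: "\<And>a b. a \<in> D \<Longrightarrow> b \<in> D \<Longrightarrow> lam a b \<in> D"
    and minv: "\<And>a. a \<in> D \<Longrightarrow> minv a \<in> D"
  shows is_brace_sub_brace: "is_brace (sub_brace B D)"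
    and bneg_sub_brace: "\<And>a. a \<in> D \<Longrightarrow> bneg (sub_brace B D) a = neg a"
proof -
  have DB: "D \<subseteq> bcarrier B" using subgroup.subset[OF D] by simp
  have gA: "group \<lparr>carrier = D, monoid.mult = bplus B, one = zero\<rparr>"
    using A.subgroup_imp_group[OF D] by (simp add: add_grp_def)
  have "subgroup D (mul_grp B)"
  proof (rule M.subgroupI)
    show "a \<boxdot> b \<in> D" if "a \<in> D" "b \<in> D" for a b
      using times_eq[of a b] lam[OF that] subgroup.m_closed[OF D, of a "lam a b"] that DB
      by (metis subsetD)
  qed (use DB minv subgroup.one_closed[OF D] in auto)
  then have gM: "group \<lparr>carrier = D, monoid.mult = btimes B, one = one (mul_grp B)\<rparr>"
    using M.subgroup_imp_group by (force simp: mul_grp_def)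
  \<comment> \<open>The units of the sub-brace come from their own descriptions. Once they are
    identified, both its groups are those of \<open>B\<close> with the carrier replaced.\<close>
  have "bzero (sub_brace B D) = zero" "bone (sub_brace B D) = one (mul_grp B)"
    using gA gM by (auto intro!: bzero_eqI bone_eqI simp: sub_brace_def)
  then have A': "add_grp (sub_brace B D) = (add_grp B)\<lparr>carrier := D\<rparr>"
    and M': "mul_grp (sub_brace B D) = (mul_grp B)\<lparr>carrier := D\<rparr>"
    by (simp_all add: add_grp_def mul_grp_def sub_brace_def)
  show neg: "bneg (sub_brace B D) a = neg a" if "a \<in> D" for a
    using A.m_inv_consistent[OF D that] by (simp add: bneg_def A')
  show "is_brace (sub_brace B D)"
    unfolding is_brace_def
  proof (intro conjI ballI)
    show "group (add_grp (sub_brace B D))" "group (mul_grp (sub_brace B D))"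
      using A.subgroup_imp_group[OF D] M.subgroup_imp_group[OF \<open>subgroup D (mul_grp B)\<close>]
      by (simp_all add: A' M')
    show "btimes (sub_brace B D) a (bplus (sub_brace B D) b c) =
        bplus (sub_brace B D) (bplus (sub_brace B D) (btimes (sub_brace B D) a b)
          (bneg (sub_brace B D) a)) (btimes (sub_brace B D) a c)"
      if "a \<in> bcarrier (sub_brace B D)" "b \<in> bcarrier (sub_brace B D)"
        "c \<in> bcarrier (sub_brace B D)" for a b c
    proof -
      have "a \<in> D" "a \<in> bcarrier B" "b \<in> bcarrier B" "c \<in> bcarrier B"
        using that DB by (auto simp: sub_brace_def)
      then show ?thesis
        using is_brace neg[of a] unfolding is_brace_def by (simp add: sub_brace_def bneg_def)
    qed
  qed
qed

section \<open>Centrality of the chain factors and the socle series of the derived ideal\<close>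

text \<open>In the quotient by \<open>I\<close> the image of \<open>J\<close> either lies in the
  socle, or is an ideal of prime order to which the two preceding results apply, since
  \<open>d\<close> maps into the derived ideal. Equality of cosets then translates back to
  membership in \<open>I\<close>.\<close>

lemma supersoluble_factor_central:
  assumes I: "brace_ideal I B" and J: "brace_ideal J B"
    and "bcarrier (quot_brace (sub_brace B J) I) \<subseteq> bsoc (quot_brace B I) \<or>
      Factorial_Ring.prime (card (bcarrier (quot_brace (sub_brace B J) I)))"
    and x: "x \<in> J" and d: "d \<in> bderived B"
  shows "neg (lam x d) \<boxplus> d \<in> I" "neg (x \<boxplus> d) \<boxplus> (d \<boxplus> x) \<in> I"
proof -
  let ?h = "\<lambda>a. a <#\<^bsub>add_grp B\<^esub> I"
  interpret q: brace_epi B "quot_brace B I" ?h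
    using quot_epi[OF I] .
  have xB: "x \<in> bcarrier B" using x brace_idealD(3)[OF J] by blast
  have dB: "d \<in> bcarrier B" using d bderived_subset by blast
  \<comment> \<open>A coset depends only on the addition, so forming it inside the sub-brace on
    \<open>J\<close> or inside \<open>B\<close> gives the same set.\<close>
  have img: "bcarrier (quot_brace (sub_brace B J) I) = ?h ` J"
    by (auto simp: quot_brace_def sub_brace_def l_coset_def add_grp_def)
  have hd: "?h d \<in> bderived (quot_brace B I)" using d q.bderived_image by blast
  have hx: "?h x \<in> ?h ` J" using x by blast
  have "blambda (quot_brace B I) (?h x) (?h d) = ?h d \<and>
      ?h x \<otimes>\<^bsub>add_grp (quot_brace B I)\<^esub> ?h d = ?h d \<otimes>\<^bsub>add_grp (quot_brace B I)\<^esub> ?h x"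
    using assms(3)
  proof
    assume "bcarrier (quot_brace (sub_brace B J) I) \<subseteq> bsoc (quot_brace B I)"
    then have "?h x \<in> bsoc (quot_brace B I)" using hx img by blast
    then show ?thesis using q.C.bsocD[of "?h x"] dB by blast
  next
    assume "Factorial_Ring.prime (card (bcarrier (quot_brace (sub_brace B J) I)))"
    then have p: "Factorial_Ring.prime (card (?h ` J))" by (simp add: img)
    note * = q.C.lam_prime_ideal_bderived[OF q.ideal_image[OF J] p hd hx]
      q.C.bderived_centralizes[OF q.ideal_image[OF J] p hd hx]
    \<comment> \<open>Centralizing is stated as d + x - d = x; \<open>inv_solve_right'\<close> moves
      the last summand across to give x + d = d + x.\<close>
    show ?thesis
      using * q.h_closed[OF xB] q.h_closed[OF dB]
        group.inv_solve_right'[OF q.group_add_grp, of "?h x" "?h d \<otimes>\<^bsub>add_grp (quot_brace B I)\<^esub> ?h x" "?h d"]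
      by simp
  qed
  then have "?h (lam x d) = ?h d" "?h (x \<boxplus> d) = ?h (d \<boxplus> x)"
    using xB dB by (simp_all add: q.h_lam)
  then show "neg (lam x d) \<boxplus> d \<in> I" "neg (x \<boxplus> d) \<boxplus> (d \<boxplus> x) \<in> I"
    using A.l_coset_eq_iff[OF brace_idealD(1)[OF I], of "lam x d" d]
      A.l_coset_eq_iff[OF brace_idealD(1)[OF I], of "x \<boxplus> d" "d \<boxplus> x"] xB dB by simp_all
qed

end

theorem theorem3p40:
  fixes B :: "'a brace"
  assumes "is_brace B" and "supersoluble B"
  shows "\<exists>n::nat. bderived B = bsocn (sub_brace B (bderived B)) n"
proof -
  interpret B: skew_brace B by unfold_locales fact
  let ?D = "bderived B"
  let ?S = "sub_brace B ?D"
  note D = B.subgroup_bderived B.bderived_subset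
  have minv: "B.minv a \<in> ?D" if "a \<in> ?D" for a
    using B.minv_eq[of a] B.lam_bderived[of "B.minv a" "B.neg a"] that D(2)
      subgroup.m_inv_closed[OF D(1) that] by auto
  have lam: "blambda B a b \<in> ?D" if "a \<in> ?D" "b \<in> ?D" for a b
    using B.lam_bderived that D(2) by blast
  have sub: "is_brace ?S" "\<And>a. a \<in> ?D \<Longrightarrow> bneg ?S a = B.neg a"
    using B.is_brace_sub_brace B.bneg_sub_brace D(1) lam minv by blast+
  interpret S: skew_brace ?S by unfold_locales (rule sub(1))
  have carrier_S: "bcarrier ?S = ?D" by (simp add: sub_brace_def)
  have add_S: "monoid.mult (add_grp ?S) = monoid.mult (add_grp B)"
    by (simp add: mult_add_grp sub_brace_def)
  have neg_S: "S.neg a = B.neg a" if "a \<in> ?D" for a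
    using sub(2)[OF that] by (simp add: bneg_def)
  have lam_S: "blambda ?S a b = blambda B a b" if "a \<in> ?D" for a b
    using sub(2)[OF that] by (simp add: blambda_def sub_brace_def bneg_def)
  obtain n I where I0: "I 0 = {bzero B}" and In: "I n = bcarrier B"
    and ideal: "\<And>i. i \<le> n \<Longrightarrow> brace_ideal (I i) B"
    and factor: "\<And>i. i < n \<Longrightarrow>
      bcarrier (quot_brace (sub_brace B (I (Suc i))) (I i)) \<subseteq> bsoc (quot_brace B (I i)) \<or>
      Factorial_Ring.prime (card (bcarrier (quot_brace (sub_brace B (I (Suc i))) (I i))))"
    using assms(2) unfolding supersoluble_def by metis
  have "?D \<inter> I i \<subseteq> bsocn ?S i" if "i \<le> n" for i
    using that
  proof (induction i)
    case 0
    \<comment> \<open>The unit of \<open>?S\<close> has its own description; being a right identity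
      for the same addition, it cancels to the unit of \<open>B\<close>.\<close>
    have "bzero ?S = bzero B"
      using S.A.r_inv S.A.one_closed B.A.r_cancel_one' add_S carrier_S D(2)
      by (metis B.A.l_cancel_one' S.A.r_one carrier_add_grp one_add_grp subsetD)
    then show ?case using I0 by simp
  next
    case (Suc i)
    show ?case
    proof
      fix x assume x: "x \<in> ?D \<inter> I (Suc i)"
      \<comment> \<open>These are the two elements demanded by \<open>mem_bsocn_Suc\<close>.
        Centrality of the factor puts them in \<open>I i\<close>, closure puts them in
        \<open>?D\<close>, and the induction hypothesis applies to the intersection.\<close>
      have "S.neg (blambda ?S x d) \<otimes>\<^bsub>add_grp ?S\<^esub> d \<in> bsocn ?S i \<and>
          S.neg (x \<otimes>\<^bsub>add_grp ?S\<^esub> d) \<otimes>\<^bsub>add_grp ?S\<^esub> (d \<otimes>\<^bsub>add_grp ?S\<^esub> x) \<in> bsocn ?S i"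
        if d: "d \<in> ?D" for d
      proof -
        have "S.neg (blambda ?S x d) \<otimes>\<^bsub>add_grp ?S\<^esub> d \<in> I i"
          "S.neg (x \<otimes>\<^bsub>add_grp ?S\<^esub> d) \<otimes>\<^bsub>add_grp ?S\<^esub> (d \<otimes>\<^bsub>add_grp ?S\<^esub> x) \<in> I i"
          using B.supersoluble_factor_central[OF ideal ideal factor, of i x d] Suc.prems x d
            subgroup.m_closed[OF D(1)] by (auto simp: add_S lam_S neg_S lam)
        moreover have "S.neg (blambda ?S x d) \<otimes>\<^bsub>add_grp ?S\<^esub> d \<in> ?D"
          "S.neg (x \<otimes>\<^bsub>add_grp ?S\<^esub> d) \<otimes>\<^bsub>add_grp ?S\<^esub> (d \<otimes>\<^bsub>add_grp ?S\<^esub> x) \<in> ?D"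
          using S.a_closed S.neg_closed S.lam_closed x d by (auto simp: carrier_S)
        ultimately show ?thesis using Suc by auto
      qed
      then show "x \<in> bsocn ?S (Suc i)"
        using x unfolding S.mem_bsocn_Suc carrier_S by blast
    qed
  qed
  \<comment> \<open>As \<open>I n\<close> is the whole brace, the length of the chain serves as the
    witness.\<close>
  from this[of n] have "?D \<subseteq> bsocn ?S n"
    using In D(2) by auto
  moreover have "bsocn ?S n \<subseteq> ?D"
    using S.brace_idealD(3)[OF S.bsocn_ideal] by (simp add: carrier_S)
  ultimately show ?thesis by blast
qed

end
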